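(* Under the aggregate no-overbidding (NOB) condition, the price of anarchy, with respect to liquid welfare, of coarse correlated equilibria in the uniform price multi-unit auction with budgets is at most $-\mathcal W_{-1}(-e^{-2})\approx3.146$. That is, for every such instance $I$ and every NOB-feasible coarse correlated equilibrium $A$ of $I$, $\mathrm{OPT}(I)\le-\mathcal W_{-1}(-e^{-2})\cdot\mathrm{LW}(I,A)$.
   Context: $\mathcal W_{-1}$ is the lower real branch of the Lambert function: $\mathcal W_{-1}(-e^{-2})$ is the unique $w\in(-\infty,-1]$ with $we^w=-e^{-2}$. Uniform price auction: bidders $N=[n]$, $n\ge2$, and $k\ge1$ identical units. Bidder $i$'s action is $a_i=(b_i,q_i)\in\mathcal A_i=\mathbb R_{\ge0}\times\{0,1,\dots,k\}$: a per-unit bid and a demanded quantity; $\mathcal A=\prod_i\mathcal A_i$. The marginal bids form the multiset containing $q_i$ copies of $b_i$ for each $i$. The $k$ units go to the $k$ highest marginal bids, ties resolved by a fixed deterministic rule (if fewer than $k$ marginal bids are submitted, all of them win and the missing entries are treated as bids of $0$); $X_i(a)\in\{0,\dots,k\}$ is the number of units won by $i$. Let $\beta_0(a)$ be the highest losing marginal bid, i.e. the $(k+1)$-st highest, with $\beta_0(a)=0$ if $\sum_iq_i\le k$. Bidder $i$ pays $P_i(a)=\beta_0(a)X_i(a)$. Bidder $i$ has a concave valuation $v_i:\{0,1,\dots,k\}\to\mathbb R_{\ge0}$ with $v_i(0)=0$ and a budget $B_i\in(0,\infty]$. Utility: $u_i(a)=v_i(X_i(a))-P_i(a)$. Feasible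 allocations: $\mathcal X=\{x\in\{0,\dots,k\}^n:\sum_ix_i\le k\}$. $\Delta(S)$ denotes probability distributions on $S$. For $A\in\Delta(\mathcal A)$ let $A_{-i}$ be the marginal on the others' actions, and let $\mathcal C_i(A_{-i})$ be the set of $A_i'\in\Delta(\mathcal A_i)$ with $\mathbb E_{a_i'\sim A_i',a_{-i}\sim A_{-i}}[P_i(a_i',a_{-i})]\le B_i$ (independent draws). $A\in\Delta(\mathcal A)$ is a coarse correlated equilibrium if for all $i$: $\mathbb E_{a\sim A}[P_i(a)]\le B_i$, and $\mathbb E_{a\sim A}[u_i(a)]\ge\mathbb E_{a_i'\sim A_i',a_{-i}\sim A_{-i}}[u_i(a_i',a_{-i})]$ for all $A_i'\in\mathcal C_i(A_{-i})$. $\mathrm{LW}(I,A)=\sum_i\min\{\mathbb E_{a\sim A}[v_i(X_i(a))],B_i\}$ and $\mathrm{OPT}(I)=\max_{\chi\in\Delta(\mathcal X)}\sum_i\min\{\mathbb E_{x\sim\chi}[v_i(x_i)],B_i\}$. The price of anarchy is the supremum of $\mathrm{OPT}(I)/\mathrm{LW}(I,A)$ over instances $I$ and equilibria $A$. Aggregate NOB: let $W_i(a)=\sup\{P_i(a_i,a_{-i}'):X_i(a_i,a_{-i}')=X_i(a)\}$ (here $W_i(a)=b_iX_i(a)$). $A$ is NOB-feasible if $\sum_i\mathbb E_{a\sim A}[W_i(a)]\le\mathrm{LW}(I,A)$. Deviations are not restricted by NOB. *)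

theory Defs
  imports "HOL-Probability.Probability"
begin

text \<open>Expectation with values in the extended reals. The Bochner integral would assign
  expectation \<open>0\<close> to a nonnegative payment of infinite mean. The indeterminate case
  \<open>\<infinity> - \<infinity>\<close> never arises below: values are bounded, and utilities are bounded above.\<close>

definition expect :: "'a measure \<Rightarrow> ('a \<Rightarrow> real) \<Rightarrow> ereal" where
  "expect M f = enn2ereal (\<integral>\<^sup>+ x. ennreal (f x) \<partial>M) - enn2ereal (\<integral>\<^sup>+ x. ennreal (- f x) \<partial>M)"

text \<open>An action is a pair of a per-unit bid and a demanded quantity. The bidders are the
  elements of a finite type \<open>'n\<close>.\<close>

type_synonym action = "real \<times> nat"
type_synonym 'n profile = "'n \<Rightarrow> action"

definition action_space :: "nat \<Rightarrow> action measure" where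
  "action_space k = restrict_space borel {0..} \<Otimes>\<^sub>M count_space {..k}"

definition profile_space :: "nat \<Rightarrow> 'n profile measure" where
  "profile_space k = PiM UNIV (\<lambda>_. action_space k)"

text \<open>All marginal bids of a profile, in nonincreasing order and with multiplicity.\<close>

definition marginal_bids :: "('n::finite) profile \<Rightarrow> real list" where
  "marginal_bids a =
     rev (sorted_list_of_multiset (\<Sum>i\<in>UNIV. replicate_mset (snd (a i)) (fst (a i))))"

text \<open>The number of units that each bidder wins under some deterministic way of breaking ties
  among the marginal bids: the multiset of winning bids consists of the \<open>k\<close> highest ones (of all
  of them if there are fewer), and nobody wins more units than demanded. Tie-breaking may depend
  on the whole profile in any measurable way.\<close>

definition allocation_rule :: "nat \<Rightarrow> (('n::finite) profile \<Rightarrow> 'n \<Rightarrow> nat) \<Rightarrow> bool" where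
  "allocation_rule k X \<longleftrightarrow>
     (\<forall>i. (\<lambda>a. X a i) \<in> measurable (profile_space k) (count_space UNIV)) \<and>
     (\<forall>a\<in>space (profile_space k).
        (\<forall>i. X a i \<le> snd (a i)) \<and>
        (\<Sum>i\<in>UNIV. replicate_mset (X a i) (fst (a i))) = mset (take k (marginal_bids a)))"

record 'n auction =
  units :: nat
  alloc :: "'n profile \<Rightarrow> 'n \<Rightarrow> nat"
  val :: "'n \<Rightarrow> nat \<Rightarrow> real"
  budget :: "'n \<Rightarrow> ereal"

definition concave_valuation :: "nat \<Rightarrow> (nat \<Rightarrow> real) \<Rightarrow> bool" where
  "concave_valuation k f \<longleftrightarrow>
     f 0 = 0 \<and> (\<forall>j\<le>k. 0 \<le> f j) \<and>
     (\<forall>j. j + 2 \<le> k \<longrightarrow> f (j + 2) - f (j + 1) \<le> f (j + 1) - f j)"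

definition uniform_price_auction :: "('n::finite) auction \<Rightarrow> bool" where
  "uniform_price_auction I \<longleftrightarrow>
     1 \<le> units I \<and> allocation_rule (units I) (alloc I) \<and>
     (\<forall>i. concave_valuation (units I) (val I i)) \<and> (\<forall>i. 0 < budget I i)"

text \<open>The highest losing marginal bid.\<close>

definition price :: "('n::finite) auction \<Rightarrow> 'n profile \<Rightarrow> real" where
  "price I a = (if units I < length (marginal_bids a) then marginal_bids a ! units I else 0)"

definition payment :: "('n::finite) auction \<Rightarrow> 'n \<Rightarrow> 'n profile \<Rightarrow> real" where
  "payment I i a = price I a * real (alloc I a i)"

definition utility :: "('n::finite) auction \<Rightarrow> 'n \<Rightarrow> 'n profile \<Rightarrow> real" where
  "utility I i a = val I i (alloc I a i) - payment I i a"

text \<open>The marginal distribution of the actions of the bidders other than \<open>i\<close>.\<close>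

definition others :: "('n::finite) auction \<Rightarrow> 'n \<Rightarrow> 'n profile measure \<Rightarrow> 'n profile measure" where
  "others I i A =
     distr A (PiM (UNIV - {i}) (\<lambda>_. action_space (units I))) (\<lambda>a. restrict a (UNIV - {i}))"

text \<open>The expectation of \<open>f\<close> when \<open>i\<close> plays the mixed action \<open>D\<close> independently of the others.\<close>

definition dev_expect ::
  "('n::finite) auction \<Rightarrow> 'n \<Rightarrow> action measure \<Rightarrow> 'n profile measure \<Rightarrow> ('n profile \<Rightarrow> real) \<Rightarrow> ereal"
where
  "dev_expect I i D A f = expect (D \<Otimes>\<^sub>M others I i A) (\<lambda>(d, a). f (a(i := d)))"

definition feasible_deviations ::
  "('n::finite) auction \<Rightarrow> 'n \<Rightarrow> 'n profile measure \<Rightarrow> action measure set"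
where
  "feasible_deviations I i A =
     {D \<in> space (prob_algebra (action_space (units I))).
        dev_expect I i D A (payment I i) \<le> budget I i}"

definition coarse_correlated_equilibrium :: "('n::finite) auction \<Rightarrow> 'n profile measure \<Rightarrow> bool" where
  "coarse_correlated_equilibrium I A \<longleftrightarrow>
     A \<in> space (prob_algebra (profile_space (units I))) \<and>
     (\<forall>i. expect A (payment I i) \<le> budget I i \<and>
          (\<forall>D\<in>feasible_deviations I i A.
             dev_expect I i D A (utility I i) \<le> expect A (utility I i)))"

definition liquid_welfare :: "('n::finite) auction \<Rightarrow> 'n profile measure \<Rightarrow> ereal" where
  "liquid_welfare I A = (\<Sum>i\<in>UNIV. min (expect A (\<lambda>a. val I i (alloc I a i))) (budget I i))"

definition feasible_allocations :: "('n::finite) auction \<Rightarrow> ('n \<Rightarrow> nat) set" where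
  "feasible_allocations I = {x. (\<forall>i. x i \<le> units I) \<and> (\<Sum>i\<in>UNIV. x i) \<le> units I}"

text \<open>There are finitely many feasible allocations, so the supremum is a maximum.\<close>

definition opt :: "('n::finite) auction \<Rightarrow> ereal" where
  "opt I = (SUP p\<in>{p. set_pmf p \<subseteq> feasible_allocations I}.
     \<Sum>i\<in>UNIV. min (expect (measure_pmf p) (\<lambda>x. val I i (x i))) (budget I i))"

text \<open>The largest payment of \<open>i\<close> that is compatible with the own action and the number of units
  won; the set is bounded, because \<open>i\<close> never pays more than the own bid per unit.\<close>

definition max_payment :: "('n::finite) auction \<Rightarrow> 'n \<Rightarrow> 'n profile \<Rightarrow> real" where
  "max_payment I i a =
     Sup {payment I i a' | a'. a' \<in> space (profile_space (units I)) \<and> a' i = a i \<and>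
                              alloc I a' i = alloc I a i}"

definition nob_feasible :: "('n::finite) auction \<Rightarrow> 'n profile measure \<Rightarrow> bool" where
  "nob_feasible I A \<longleftrightarrow> (\<Sum>i\<in>UNIV. expect A (max_payment I i)) \<le> liquid_welfare I A"

text \<open>The lower real branch of the Lambert function, on \<open>[-1/e, 0)\<close>.\<close>

definition lambert_Wm1 :: "real \<Rightarrow> real" where
  "lambert_Wm1 y = (THE w. w \<le> -1 \<and> w * exp w = y)"

end

theory Submission
  imports Defs
begin

text \<open>Every bidder \<open>i\<close> can deviate as follows: draw a quantity \<open>q\<close> from the bidder's share of an
  optimal lottery, thinned so that its expected value does not exceed the budget, and bid
  \<open>b = v q / q * (1 - exp (- s * u))\<close> per unit with \<open>u\<close> uniform on \<open>[0, 1]\<close>. The payment is at most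
  \<open>b * q \<le> v q\<close>, so the deviation is feasible. If \<open>N t\<close> is the number of marginal bids of at least
  \<open>t\<close>, the deviator wins at least \<open>min q (k - N b)\<close> units, each of which contributes at least
  \<open>v q / q - b\<close> to the utility. The density of \<open>b\<close> is \<open>1 / (s * (v q / q - b))\<close>, so \<open>s\<close> times the
  expected utility is at least the integral of \<open>min q (k - N t)\<close> over
  \<open>0 \<le> t \<le> (1 - exp (- s)) * v q / q\<close>, which is at least \<open>(1 - exp (- s)) * v q\<close> minus the integral
  of the excess \<open>q - (k - N t)\<close> (truncated at \<open>0\<close>) over all \<open>t \<ge> 0\<close>. For a feasible allocation the
  excesses at level \<open>t\<close> add up to at most \<open>min k (N t)\<close>, the number of winning bids of at least \<open>t\<close>,
  whose integral is the sum of the winning bids; no-overbidding bounds this sum by the liquid welfare.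
  Together \<open>(1 - exp (- s)) * OPT \<le> (1 + s) * LW\<close>, and the best choice \<open>exp s = 2 + s\<close> gives the
  ratio \<open>2 + s\<close>. Bidders whose liquid welfare equals their budget satisfy the bound trivially.\<close>

section \<open>Ordered marginal bids and the winners above a level\<close>

text \<open>Rivals who bid exactly \<open>t\<close> are counted too, so the later bounds treat every
  tie as lost by the deviator and hold for each tie-breaking rule.\<close>

definition demand :: "'n set \<Rightarrow> real \<Rightarrow> 'n profile \<Rightarrow> nat" where
  "demand S t a = (\<Sum>l\<in>S. if t \<le> fst (a l) then snd (a l) else 0)"

lemma demand_mono: "finite T \<Longrightarrow> S \<subseteq> T \<Longrightarrow> demand S t a \<le> demand T t a"
  unfolding demand_def by (rule sum_mono2) auto

lemma space_action_space: "space (action_space k) = {0..} \<times> {..k}"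
  by (simp add: action_space_def space_pair_measure space_restrict_space)

lemma space_profile_space:
  "a \<in> space (profile_space k) \<longleftrightarrow> (\<forall>i. 0 \<le> fst (a i) \<and> snd (a i) \<le> k)"
  by (auto simp: profile_space_def space_action_space space_PiM PiE_iff mem_Times_iff)

text \<open>In a nonincreasing list the entries of at least \<open>t\<close> form a prefix.\<close>

lemma length_filter_take:
  fixes t :: "'a::linorder"
  assumes "sorted_wrt (\<ge>) xs"
  shows "length (filter (\<lambda>x. t \<le> x) (take k xs)) = min k (length (filter (\<lambda>x. t \<le> x) xs))"
  using assms
proof (induction xs arbitrary: k)
  case (Cons x xs)
  show ?case
  proof (cases k)
    case (Suc m)
    have "filter (\<lambda>x. t \<le> x) xs = []" if "\<not> t \<le> x"
      using Cons.prems that by (auto simp: filter_empty_conv)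
    then show ?thesis
      using Cons Suc by auto
  qed simp
qed simp

lemma nth_ge_if_less_length_filter:
  fixes t :: "'a::linorder"
  assumes "sorted_wrt (\<ge>) xs" and "k < length (filter (\<lambda>x. t \<le> x) xs)"
  shows "k < length xs" "t \<le> xs ! k"
proof -
  show k: "k < length xs"
    using assms(2) length_filter_le[of _ xs] by (rule less_le_trans)
  show "t \<le> xs ! k"
  proof (rule ccontr)
    assume "\<not> t \<le> xs ! k"
    moreover have "x \<le> xs ! k" if x: "x \<in> set (drop k xs)" for x
    proof -
      from x obtain j where "j < length xs - k" "x = xs ! (k + j)"
        by (auto simp: in_set_conv_nth)
      then show ?thesis
        using sorted_wrt_nth_less[OF assms(1), of k "k + j"] by (cases "j = 0") auto
    qed
    ultimately have "filter (\<lambda>x. t \<le> x) (drop k xs) = []"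
      by (force simp: filter_empty_conv)
    then have "length (filter (\<lambda>x. t \<le> x) (take k xs)) = length (filter (\<lambda>x. t \<le> x) xs)"
      by (metis append_Nil2 append_take_drop_id filter_append)
    then show False
      using assms length_filter_take[OF assms(1), of t k] by simp
  qed
qed

lemma sorted_marginal_bids: "sorted_wrt (\<ge>) (marginal_bids a)"
  by (simp add: marginal_bids_def sorted_wrt_rev)

lemma mset_marginal_bids:
  "mset (marginal_bids a) = (\<Sum>i\<in>UNIV. replicate_mset (snd (a i)) (fst (a i)))"
  by (simp add: marginal_bids_def)

lemma size_filter_sum_replicate_mset:
  "finite S \<Longrightarrow> size (filter_mset P (\<Sum>i\<in>S. replicate_mset (f i) (g i))) =
    (\<Sum>i\<in>S. if P (g i) then f i else 0)"
proof (induction S rule: finite_induct)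
  case (insert j S)
  have "size (filter_mset P (replicate_mset n y)) = (if P y then n else 0)" for n y
    by (induction n) auto
  then show ?case
    using insert by simp
qed simp

lemma length_filter_marginal_bids:
  "length (filter (\<lambda>x. t \<le> x) (marginal_bids a)) = demand UNIV t a"
  unfolding demand_def size_mset[symmetric] mset_filter mset_marginal_bids
  by (rule size_filter_sum_replicate_mset) simp

lemma set_marginal_bids: "x \<in> set (marginal_bids a) \<Longrightarrow> \<exists>i. x = fst (a i)"
proof -
  assume "x \<in> set (marginal_bids a)"
  then have "x \<in># (\<Sum>i\<in>UNIV. replicate_mset (snd (a i)) (fst (a i)))"
    by (simp flip: mset_marginal_bids)
  then show ?thesis
    by (auto simp: set_mset_sum split: if_splits)
qed

lemma alloc_le_quantity:
  "allocation_rule k X \<Longrightarrow> a \<in> space (profile_space k) \<Longrightarrow> X a i \<le> snd (a i)"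
  by (simp add: allocation_rule_def)

text \<open>Tie-breaking only decides who owns the winning copies of one bid value. All these copies
  lie on the same side of \<open>t\<close>, so the count is the same for every rule.\<close>

lemma sum_winners_above:
  assumes "allocation_rule k X" and "a \<in> space (profile_space k)"
  shows "(\<Sum>i\<in>UNIV. if t \<le> fst (a i) then X a i else 0) = min k (demand UNIV t a)"
proof -
  have "(\<Sum>i\<in>UNIV. if t \<le> fst (a i) then X a i else 0) =
      size (filter_mset (\<lambda>x. t \<le> x) (\<Sum>i\<in>UNIV. replicate_mset (X a i) (fst (a i))))"
    by (rule size_filter_sum_replicate_mset[symmetric]) simp
  also have "\<dots> = length (filter (\<lambda>x. t \<le> x) (take k (marginal_bids a)))"
    using assms by (simp add: allocation_rule_def flip: mset_filter size_mset)
  finally show ?thesis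
    by (simp add: length_filter_take[OF sorted_marginal_bids] length_filter_marginal_bids)
qed

text \<open>Let \<open>N\<close> be the demand of the rivals at the level of the own bid and
  \<open>q\<close> the own demand. Then \<open>min k (q + N)\<close> units are won at this level or
  above, at most \<open>N\<close> of them by rivals.\<close>

lemma alloc_ge:
  fixes X :: "('n::finite) profile \<Rightarrow> 'n \<Rightarrow> nat"
  assumes "allocation_rule k X" and "a \<in> space (profile_space k)"
  shows "min (snd (a i)) (k - demand (UNIV - {i}) (fst (a i)) a) \<le> X a i"
proof -
  let ?t = "fst (a i)"
  have "(\<Sum>l\<in>UNIV. if ?t \<le> fst (a l) then X a l else 0) =
      X a i + (\<Sum>l\<in>UNIV-{i}. if ?t \<le> fst (a l) then X a l else 0)"
    by (subst sum.remove[of _ i]) auto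
  moreover have "(\<Sum>l\<in>UNIV-{i}. if ?t \<le> fst (a l) then X a l else 0) \<le>
      demand (UNIV - {i}) ?t a"
    unfolding demand_def by (rule sum_mono) (use alloc_le_quantity[OF assms] in auto)
  moreover have "demand UNIV ?t a = snd (a i) + demand (UNIV - {i}) ?t a"
    unfolding demand_def by (subst sum.remove[of _ i]) auto
  ultimately show ?thesis
    using sum_winners_above[OF assms, of ?t] by linarith
qed

section \<open>Prices, payments and the largest compatible payment\<close>

lemma price_ge:
  "units I < demand UNIV t a \<Longrightarrow> t \<le> price I a"
  using nth_ge_if_less_length_filter[OF sorted_marginal_bids, of "units I" t a]
  by (simp add: price_def length_filter_marginal_bids)

lemma price_nonneg:
  "a \<in> space (profile_space k) \<Longrightarrow> 0 \<le> price I a"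
  unfolding price_def space_profile_space
  using set_marginal_bids[of "marginal_bids a ! units I" a]
  by (auto dest: nth_mem)

text \<open>A winning bid has an index below \<open>units I\<close> in the nonincreasing list, while
  the price is the entry at index \<open>units I\<close>, or 0 if there is none.\<close>

lemma price_le_bid:
  assumes "allocation_rule (units I) (alloc I)" and a: "a \<in> space (profile_space (units I))"
    and "0 < alloc I a i"
  shows "price I a \<le> fst (a i)"
proof (cases "units I < length (marginal_bids a)")
  case True
  have "fst (a i) \<in># (\<Sum>i\<in>UNIV. replicate_mset (alloc I a i) (fst (a i)))"
    using assms(3) by (auto simp: set_mset_sum intro!: exI[of _ i])
  then have "fst (a i) \<in> set (take (units I) (marginal_bids a))"
    using assms by (simp add: allocation_rule_def)
  then obtain j where "j < units I" "fst (a i) = marginal_bids a ! j"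
    by (auto simp: in_set_conv_nth)
  then show ?thesis
    using sorted_wrt_nth_less[OF sorted_marginal_bids, of j "units I" a] True
    by (simp add: price_def)
next
  case False
  then show ?thesis
    using a by (simp add: price_def space_profile_space)
qed

lemma payment_le:
  assumes "allocation_rule (units I) (alloc I)" and "a \<in> space (profile_space (units I))"
  shows "payment I i a \<le> fst (a i) * alloc I a i"
  using price_le_bid[OF assms, of i]
  by (cases "alloc I a i = 0") (auto simp: payment_def intro!: mult_right_mono)

lemma payment_nonneg: "a \<in> space (profile_space k) \<Longrightarrow> 0 \<le> payment I i a"
  by (simp add: payment_def price_nonneg)

lemma max_payment_upper:
  assumes "allocation_rule (units I) (alloc I)"
    and "a' \<in> space (profile_space (units I))" "a' i = a i" "alloc I a' i = alloc I a i"
  shows "payment I i a' \<le> max_payment I i a"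
  unfolding max_payment_def
proof (rule cSup_upper)
  show "bdd_above {payment I i a' |a'. a' \<in> space (profile_space (units I)) \<and>
      a' i = a i \<and> alloc I a' i = alloc I a i}"
    by (rule bdd_aboveI[of _ "fst (a i) * alloc I a i"]) (use payment_le[OF assms(1), of _ i] in \<open>force\<close>)
qed (use assms in auto)

lemma sum_two:
  fixes f :: "'n::finite \<Rightarrow> nat"
  assumes "i \<noteq> j" "\<And>l. l \<noteq> i \<Longrightarrow> l \<noteq> j \<Longrightarrow> f l = 0"
  shows "sum f UNIV = f i + f j"
proof -
  have "sum f UNIV = sum f {i, j}"
    by (rule sum.mono_neutral_right) (use assms in auto)
  then show ?thesis
    using assms(1) by simp
qed

text \<open>Through this inequality no-overbidding controls the sum of the winning bids. A second
  bidder must exist: the demand of one bidder alone never exceeds the supply, so the price would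
  stay 0.\<close>

lemma max_payment_ge:
  fixes I :: "('n::finite) auction"
  assumes n: "2 \<le> CARD('n)" and X: "allocation_rule (units I) (alloc I)"
    and a: "a \<in> space (profile_space (units I))"
  shows "fst (a i) * alloc I a i \<le> max_payment I i a"
proof -
  obtain j where ij: "i \<noteq> j"
  proof -
    have "UNIV \<noteq> {i}"
    proof
      assume "UNIV = {i}"
      then have "CARD('n) = card {i}" by (rule arg_cong)
      then show False using n by simp
    qed
    then obtain j where "j \<notin> {i}" by blast
    then show ?thesis using that[of j] by simp
  qed
  define b q m where "b = fst (a i)" and "q = snd (a i)" and "m = alloc I a i"
  have b: "0 \<le> b" and q: "q \<le> units I"
    using a by (auto simp: space_profile_space b_def q_def)
  have m: "m \<le> q"
    unfolding m_def q_def using X a by (rule alloc_le_quantity)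
  have ai: "a i = (b, q)"
    by (simp add: b_def q_def)
  define rival where "rival d = (\<lambda>_. (0, 0))(i := (b, q), j := d)" for d :: action
  have rival_space: "rival (c, r) \<in> space (profile_space (units I))"
    if "0 \<le> c" "r \<le> units I" for c r
    using that b q by (simp add: space_profile_space rival_def)
  have demand_rival: "demand UNIV t (rival (c, r)) =
      (if t \<le> b then q else 0) + (if t \<le> c then r else 0)" for t c r
    unfolding demand_def by (subst sum_two[OF ij]) (use ij in \<open>auto simp: rival_def\<close>)
  have winners: "min (units I) (demand UNIV t (rival (c, r))) =
      (if t \<le> b then alloc I (rival (c, r)) i else 0) +
      (if t \<le> c then alloc I (rival (c, r)) j else 0)"
    if "0 \<le> c" "r \<le> units I" for t c r
    unfolding sum_winners_above[OF X rival_space[OF that], symmetric]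
  proof (subst sum_two[OF ij])
    fix l assume "l \<noteq> i" "l \<noteq> j"
    then show "(if t \<le> fst (rival (c, r) l) then alloc I (rival (c, r)) l else 0) = 0"
      using alloc_le_quantity[OF X rival_space[OF that], of l] by (simp add: rival_def)
  qed (use ij in \<open>simp add: rival_def\<close>)
  have use_rival: "price I (rival d) * m \<le> max_payment I i a"
    if "rival d \<in> space (profile_space (units I))" "alloc I (rival d) i = m" for d
    using max_payment_upper[OF X that(1), of i a] that ij
    by (simp add: payment_def rival_def ai m_def)
  \<comment> \<open>With \<open>m < q\<close> units won, a rival who outbids \<open>i\<close> on \<open>k - m\<close> units makes \<open>b\<close> itself the price.
    With \<open>m = q\<close>, the rival has to stay slightly below \<open>b\<close>, and the supremum is only approached.\<close>
  show ?thesis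
  proof (cases "b = 0 \<or> m = 0")
    case True
    moreover have "0 \<le> max_payment I i a"
      using max_payment_upper[OF X a, of i a] payment_nonneg[OF a, of I i] by simp
    ultimately show ?thesis
      by (auto simp: b_def m_def)
  next
    case False
    then have pos: "0 < b" "0 < m" using b by auto
    show ?thesis
    proof (cases "m < q")
      case True
      let ?a = "rival (b + 1, units I - m)"
      have sp: "?a \<in> space (profile_space (units I))"
        by (rule rival_space) (use b in auto)
      \<comment> \<open>Level \<open>b + 1\<close> counts only the rival's units. Level
        \<open>b\<close> counts those of both and is saturated because \<open>m < q\<close>, which
        leaves exactly \<open>m\<close> units for \<open>i\<close>.\<close>
      have "alloc I ?a j = units I - m"
        using winners[of "b + 1" "units I - m" "b + 1"] b by (simp add: demand_rival)
      then have "alloc I ?a i = m"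
        using winners[of "b + 1" "units I - m" b] b True q by (simp add: demand_rival)
      moreover have "b \<le> price I ?a"
        by (rule price_ge) (use True q in \<open>simp add: demand_rival\<close>)
      ultimately show ?thesis
        using use_rival[OF sp] mult_right_mono[of b "price I ?a" "real m"]
        by (simp add: b_def m_def)
    next
      case False
      then have mq: "m = q" using m by simp
      have below: "(b - e) * m \<le> max_payment I i a" if e: "0 < e" "e \<le> b" for e
      proof -
        let ?a = "rival (b - e, units I)"
        have sp: "?a \<in> space (profile_space (units I))"
          by (rule rival_space) (use e in auto)
        \<comment> \<open>At level \<open>b\<close> only the \<open>q\<close> units of
          \<open>i\<close> count, so all of them win. At level \<open>b - e\<close> the demand is
          \<open>q + units I\<close>, which exceeds the supply.\<close>
        have "alloc I ?a i = m"
          using winners[of "b - e" "units I" b] e q by (simp add: demand_rival mq)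
        moreover have "b - e \<le> price I ?a"
          by (rule price_ge) (use pos mq e in \<open>simp add: demand_rival\<close>)
        ultimately show ?thesis
          using use_rival[OF sp] mult_right_mono[of "b - e" "price I ?a" "real m"] by simp
      qed
      have "b * m \<le> max_payment I i a"
      proof (rule field_le_epsilon)
        fix e :: real assume "0 < e"
        \<comment> \<open>\<open>d <= b\<close> keeps the rival's bid nonnegative, and
          \<open>d * m <= e\<close> bounds the loss.\<close>
        define d where "d = min b (e / m)"
        have "0 < d" "d \<le> b" "d * m \<le> e"
          using \<open>0 < e\<close> pos by (auto simp: d_def min_def field_simps)
        then show "b * m \<le> max_payment I i a + e"
          using below[of d] by (simp add: algebra_simps)
      qed
      then show ?thesis
        by (simp add: b_def m_def)
    qed
  qed
qed

section \<open>Concave valuations and the utility of a deviator\<close>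

lemma valuation_nonneg: "uniform_price_auction I \<Longrightarrow> q \<le> units I \<Longrightarrow> 0 \<le> val I i q"
  unfolding uniform_price_auction_def concave_valuation_def by blast

lemma valuation_zero: "uniform_price_auction I \<Longrightarrow> val I i 0 = 0"
  unfolding uniform_price_auction_def concave_valuation_def by blast

text \<open>By concavity each increment is at most the average of the earlier ones
  (\<open>diff\<close>), so the average value per unit cannot increase. The product form also covers
  \<open>m = 0\<close>.\<close>

lemma concave_valuation_ratio:
  assumes "concave_valuation k v" "m \<le> q" "q \<le> k"
  shows "real m * v q \<le> real q * v m"
proof -
  have diff: "real j * (v (Suc j) - v j) \<le> v j" if "Suc j \<le> k" for j
    using that
  proof (induction j)
    case 0
    then show ?case using assms(1) by (simp add: concave_valuation_def)
  next
    case (Suc j)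
    have "v (j + 2) - v (j + 1) \<le> v (j + 1) - v j"
      using assms(1) Suc.prems by (simp add: concave_valuation_def)
    then have "real (Suc j) * (v (Suc (Suc j)) - v (Suc j)) \<le> real (Suc j) * (v (Suc j) - v j)"
      by (intro mult_left_mono) auto
    also have "\<dots> \<le> v (Suc j)"
      using Suc by (simp add: algebra_simps)
    finally show ?case .
  qed
  show ?thesis
    using assms(2,3)
  proof (induction q rule: dec_induct)
    case (step q)
    show ?case
    proof (cases "q = 0")
      case True
      then show ?thesis
        using step assms(1) by (auto simp: concave_valuation_def)
    next
      case False
      have "real m * (real q * v (Suc q)) \<le> real m * (real (Suc q) * v q)"
        using diff[of q] step by (intro mult_left_mono) (auto simp: algebra_simps)
      also have "\<dots> \<le> real (Suc q) * (real q * v m)"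
        using mult_left_mono[OF step.IH, of "real (Suc q)"] step by (simp add: mult_ac)
      finally have "real q * (real m * v (Suc q)) \<le> real q * (real (Suc q) * v m)"
        by (simp add: mult_ac)
      then show ?thesis
        using False by simp
    qed
  qed simp
qed

text \<open>By concavity the units won are worth at least \<open>val I i q / q\<close> each, and
  each costs at most \<open>b\<close>. The assumption on \<open>b\<close> makes this surplus
  nonnegative, so the number of units won may be replaced by its lower bound from
  \<open>alloc_ge\<close>.\<close>

lemma utility_ge:
  assumes I: "uniform_price_auction I" and a: "a \<in> space (profile_space (units I))"
    and ai: "a i = (b, q)" and b: "b * real q \<le> val I i q"
  shows "(val I i q / q - b) * min q (units I - demand (UNIV - {i}) b a) \<le> utility I i a"
proof -
  note X = I[unfolded uniform_price_auction_def, THEN conjunct2, THEN conjunct1]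
  let ?x = "alloc I a i"
  have conc: "concave_valuation (units I) (val I i)"
    using I by (simp add: uniform_price_auction_def)
  have q: "q \<le> units I" and xq: "?x \<le> q"
    using a ai alloc_le_quantity[OF X a, of i] by (auto simp: space_profile_space dest: spec[of _ i])
  show ?thesis
  proof (cases "q = 0")
    case True
    then show ?thesis
      using xq conc by (simp add: utility_def payment_def concave_valuation_def)
  next
    case False
    have "(val I i q / q - b) * min q (units I - demand (UNIV - {i}) b a) \<le>
        (val I i q / q - b) * ?x"
      using alloc_ge[OF X a, of i] ai b False
      by (intro mult_left_mono) (auto simp: field_simps simp flip: of_nat_min)
    also have "\<dots> \<le> val I i ?x - b * ?x"
      using concave_valuation_ratio[OF conc xq q] False by (simp add: field_simps)
    also have "\<dots> \<le> utility I i a"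
      using payment_le[OF X a, of i] ai by (simp add: utility_def)
    finally show ?thesis .
  qed
qed

text \<open>Let \<open>c = k - N\<close>. If some \<open>x i\<close> exceeds \<open>c\<close>, this
  one term already saves \<open>c\<close>, and the sum is at most \<open>k - c = min k N\<close>.
  Otherwise every truncated difference is 0.\<close>

lemma sum_excess_le:
  fixes x :: "'n \<Rightarrow> nat"
  assumes "finite S" "sum x S \<le> k"
  shows "(\<Sum>i\<in>S. x i - (k - N)) \<le> min k N"
proof (cases "\<exists>i\<in>S. k - N < x i")
  case True
  then obtain i where i: "i \<in> S" "k - N < x i" by blast
  have "(\<Sum>l\<in>S. x l - (k - N)) \<le> k"
    using sum_mono[of S "\<lambda>l. x l - (k - N)" x] assms by simp
  moreover have "(\<Sum>l\<in>S. x l - (k - N)) = (x i - (k - N)) + (\<Sum>l\<in>S-{i}. x l - (k - N))"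
    using assms i by (simp add: sum.remove)
  moreover have "(\<Sum>l\<in>S-{i}. x l - (k - N)) \<le> sum x (S - {i})"
    by (rule sum_mono) simp
  ultimately show ?thesis
    using assms(2) i(2) sum.remove[OF assms(1) i(1), of x] by linarith
qed (simp add: not_less)

section \<open>Measurability of actions and extended expectations\<close>

lemma measurable_fst_action [measurable]: "fst \<in> borel_measurable (action_space k)"
proof -
  have "(\<lambda>x. x) \<in> borel_measurable (restrict_space borel {0::real..})"
    by (rule measurable_restrict_space1) simp
  from measurable_compose[OF measurable_fst this] show ?thesis
    by (simp add: action_space_def)
qed

lemma measurable_snd_action [measurable]:
  "snd \<in> measurable (action_space k) (count_space UNIV)"
proof -
  have "(\<lambda>x. x) \<in> measurable (count_space {..k}) (count_space UNIV)"
    by simp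
  from measurable_compose[OF measurable_snd this] show ?thesis
    by (simp add: action_space_def)
qed

lemma measurable_action_Pair:
  assumes [measurable]: "f \<in> borel_measurable M" "g \<in> measurable M (count_space UNIV)"
    and "\<And>x. x \<in> space M \<Longrightarrow> 0 \<le> f x \<and> g x \<le> k"
  shows "(\<lambda>x. (f x, g x)) \<in> measurable M (action_space k)"
  unfolding action_space_def
proof (rule measurable_Pair)
  show "f \<in> measurable M (restrict_space borel {0..})"
    using assms by (intro measurable_restrict_space2) auto
  have "g \<in> measurable M (restrict_space (count_space UNIV) {..k})"
    using assms by (intro measurable_restrict_space2) auto
  then show "g \<in> measurable M (count_space {..k})"
    by (simp add: restrict_count_space)
qed

lemma measurable_demand:
  assumes "finite S"
    and [measurable]: "f \<in> borel_measurable M" "g \<in> measurable M (PiM T (\<lambda>_. action_space k))"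
    and ST: "S \<subseteq> T"
  shows "(\<lambda>x. demand S (f x) (g x)) \<in> measurable M (count_space UNIV)"
proof -
  have "(\<lambda>x. if f x \<le> fst (g x l) then snd (g x l) else 0) \<in> measurable M (count_space UNIV)"
    if "l \<in> S" for l
  proof -
    have [measurable]: "l \<in> T" using that ST by auto
    show ?thesis by measurable
  qed
  then show ?thesis
    unfolding demand_def by (intro measurable_sum_nat)
qed

lemma expect_nonneg:
  assumes "AE x in M. 0 \<le> f x"
  shows "expect M f = enn2ereal (\<integral>\<^sup>+ x. ennreal (f x) \<partial>M)"
proof -
  have "(\<integral>\<^sup>+ x. ennreal (- f x) \<partial>M) = (\<integral>\<^sup>+ x. 0 \<partial>M)"
    by (rule nn_integral_cong_AE) (use assms in \<open>auto simp: ennreal_neg\<close>)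
  then show ?thesis
    by (simp add: expect_def zero_ennreal.rep_eq)
qed

lemma expect_le:
  assumes "\<And>x. x \<in> space M \<Longrightarrow> f x \<le> g x"
  shows "expect M f \<le> enn2ereal (\<integral>\<^sup>+ x. ennreal (g x) \<partial>M)"
proof -
  have "expect M f \<le> enn2ereal (\<integral>\<^sup>+ x. ennreal (f x) \<partial>M)"
    unfolding expect_def by (rule ereal_diff_le_self) simp
  also have "\<dots> \<le> enn2ereal (\<integral>\<^sup>+ x. ennreal (g x) \<partial>M)"
    unfolding less_eq_ennreal.rep_eq[symmetric] by (intro nn_integral_mono ennreal_leI assms)
  finally show ?thesis .
qed

section \<open>The random deviation\<close>

text \<open>Inverse transform sampling of a bid \<open>b\<close> with density proportional to \<open>1 / (v q / q - b)\<close>; the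
  bid is \<open>0\<close> for \<open>q = 0\<close>.\<close>

definition random_bid :: "real \<Rightarrow> (nat \<Rightarrow> real) \<Rightarrow> nat \<Rightarrow> real \<Rightarrow> real" where
  "random_bid s v q u = v q / q * (1 - exp (- (s * u)))"

text \<open>The truncations are vacuous on the support; they make the map land in the action space for
  every \<open>q\<close> and \<open>u\<close>.\<close>

definition deviation :: "real \<Rightarrow> (nat \<Rightarrow> real) \<Rightarrow> nat \<Rightarrow> nat pmf \<Rightarrow> action measure" where
  "deviation s v k Q =
     distr (measure_pmf Q \<Otimes>\<^sub>M uniform_measure lborel {0..1}) (action_space k)
       (\<lambda>(q, u). (max 0 (random_bid s v (min q k) u), min q k))"

lemma prob_space_unit_uniform: "prob_space (uniform_measure lborel {0..1::real})"
  by (rule prob_space_uniform_measure) auto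

lemma measurable_deviation [measurable]:
  "(\<lambda>(q, u). (max 0 (random_bid s v (min q k) u), min q k)) \<in>
    measurable (measure_pmf Q \<Otimes>\<^sub>M uniform_measure lborel {0..1}) (action_space k)"
proof -
  have "(\<lambda>x. max 0 (random_bid s v (min (fst x) k) (snd x))) \<in>
      borel_measurable (measure_pmf Q \<Otimes>\<^sub>M uniform_measure lborel {0..1})"
  proof (rule measurable_compose_countable[where g = fst])
    show "(\<lambda>x. max 0 (random_bid s v (min q k) (snd x))) \<in>
        borel_measurable (measure_pmf Q \<Otimes>\<^sub>M uniform_measure lborel {0..1})" for q
      unfolding random_bid_def by measurable
    show "fst \<in> measurable (measure_pmf Q \<Otimes>\<^sub>M uniform_measure lborel {0..1}) (count_space UNIV)"
      by measurable
  qed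
  then show ?thesis
    unfolding split_beta' by (intro measurable_action_Pair) auto
qed

lemma deviation_in_prob_algebra: "deviation s v k Q \<in> space (prob_algebra (action_space k))"
proof -
  interpret U: prob_space "uniform_measure lborel {0..1::real}"
    by (rule prob_space_unit_uniform)
  interpret P: pair_prob_space "measure_pmf Q" "uniform_measure lborel {0..1::real}" ..
  show ?thesis
    unfolding space_prob_algebra deviation_def
    by (auto intro!: P.prob_space_distr)
qed

text \<open>The factor \<open>1 - exp (- (s * u))\<close> is below 1, so no drawn bid exceeds the
  average value \<open>v q / q\<close>. This yields both the budget feasibility and the nonnegative
  utility of the deviation.\<close>

lemma AE_deviation:
  assumes "0 \<le> s" "\<And>q. q \<le> k \<Longrightarrow> 0 \<le> v q"
  shows "AE d in deviation s v k Q. fst d * real (snd d) \<le> v (snd d)"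
  unfolding deviation_def
proof (subst AE_distr_iff)
  show "{d \<in> space (action_space k). fst d * real (snd d) \<le> v (snd d)} \<in> sets (action_space k)"
    by measurable
  have "max 0 (random_bid s v q u) * real q \<le> v q" if "q \<le> k" for q u
  proof (cases "q = 0")
    case False
    have "v q * (1 - exp (- (s * u))) \<le> v q * 1"
      using assms(2)[OF that] by (intro mult_left_mono) auto
    then show ?thesis
      using False assms(2)[OF that] by (auto simp: random_bid_def max_def)
  qed (use assms that in auto)
  then show "AE x in measure_pmf Q \<Otimes>\<^sub>M uniform_measure lborel {0..1}.
      fst (case x of (q, u) \<Rightarrow> (max 0 (random_bid s v (min q k) u), min q k)) *
      real (snd (case x of (q, u) \<Rightarrow> (max 0 (random_bid s v (min q k) u), min q k)))
      \<le> v (snd (case x of (q, u) \<Rightarrow> (max 0 (random_bid s v (min q k) u), min q k)))"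
    by (intro AE_I2) (auto simp del: of_nat_min)
qed simp

lemma nn_integral_deviation:
  assumes [measurable]: "f \<in> borel_measurable (action_space k)"
    and Q: "set_pmf Q \<subseteq> {..k}" and s: "0 \<le> s" and v: "\<And>q. q \<le> k \<Longrightarrow> 0 \<le> v q"
  shows "(\<integral>\<^sup>+ d. f d \<partial>deviation s v k Q) =
    (\<integral>\<^sup>+ q. \<integral>\<^sup>+ u. f (random_bid s v q u, q) * indicator {0..1} u \<partial>lborel \<partial>measure_pmf Q)"
proof -
  interpret U: prob_space "uniform_measure lborel {0..1::real}"
    by (rule prob_space_unit_uniform)
  let ?F = "\<lambda>(q, u). (max 0 (random_bid s v (min q k) u), min q k)"
  have "(\<integral>\<^sup>+ d. f d \<partial>deviation s v k Q) =
      (\<integral>\<^sup>+ x. f (?F x) \<partial>(measure_pmf Q \<Otimes>\<^sub>M uniform_measure lborel {0..1}))"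
    unfolding deviation_def by (rule nn_integral_distr) measurable
  also have "\<dots> = (\<integral>\<^sup>+ q. \<integral>\<^sup>+ u. f (?F (q, u)) \<partial>uniform_measure lborel {0..1} \<partial>measure_pmf Q)"
    by (rule U.nn_integral_fst[symmetric]) measurable
  also have "\<dots> = (\<integral>\<^sup>+ q. \<integral>\<^sup>+ u. f (random_bid s v q u, q) * indicator {0..1} u \<partial>lborel \<partial>measure_pmf Q)"
  proof (rule nn_integral_cong_AE, unfold AE_measure_pmf_iff, intro ballI)
    fix q assume "q \<in> set_pmf Q"
    then have q: "q \<le> k" using Q by auto
    have [measurable]: "(\<lambda>u. (max 0 (random_bid s v q u), q)) \<in> measurable lborel (action_space k)"
      by (rule measurable_action_Pair) (use q in \<open>auto simp: random_bid_def\<close>)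
    have "(\<integral>\<^sup>+ u. f (?F (q, u)) \<partial>uniform_measure lborel {0..1}) =
        (\<integral>\<^sup>+ u. f (max 0 (random_bid s v q u), q) * indicator {0..1} u \<partial>lborel)"
      using q by (simp add: nn_integral_uniform_measure divide_ennreal_def)
    also have "\<dots> = (\<integral>\<^sup>+ u. f (random_bid s v q u, q) * indicator {0..1} u \<partial>lborel)"
    proof (rule nn_integral_cong)
      fix u :: real
      have "0 \<le> random_bid s v q u" if "0 \<le> u"
        using that s v[OF q] by (simp add: random_bid_def)
      then show "f (max 0 (random_bid s v q u), q) * indicator {0..1} u =
          f (random_bid s v q u, q) * indicator {0..1} u"
        by (auto simp: max_def split: split_indicator)
    qed
    finally show "(\<integral>\<^sup>+ u. f (?F (q, u)) \<partial>uniform_measure lborel {0..1}) =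
        (\<integral>\<^sup>+ u. f (random_bid s v q u, q) * indicator {0..1} u \<partial>lborel)" .
  qed
  finally show ?thesis .
qed

text \<open>Up to the factor \<open>s\<close>, the surplus per unit is the derivative of the bid in
  \<open>u\<close>. Substituting the bid for \<open>u\<close> therefore turns the surplus integral
  into a plain integral of guaranteed units over bid levels.\<close>

lemma nn_integral_random_bid:
  fixes N :: "real \<Rightarrow> nat"
  assumes [measurable]: "N \<in> measurable borel (count_space UNIV)"
    and s: "0 < s" and v: "0 \<le> v q" "q = 0 \<Longrightarrow> v q = 0"
  shows "ennreal ((1 - exp (- s)) * v q) \<le>
    ennreal s * (\<integral>\<^sup>+ u. ennreal ((v q / q - random_bid s v q u) *
      min q (k - N (random_bid s v q u))) * indicator {0..1} u \<partial>lborel) +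
    (\<integral>\<^sup>+ t. ennreal (q - (k - N t)) * indicator {0..} t \<partial>lborel)"
proof (cases "v q = 0")
  case False
  then have q: "0 < q" and pos: "0 < v q" using v by (auto intro: gr0I)
  define w where "w = v q / q"
  have w: "0 < w" "w * q = v q" using pos q by (auto simp: w_def)
  define g where "g t = real (min q (k - N t))" for t
  have [measurable]: "g \<in> borel_measurable borel"
    unfolding g_def by measurable
  have bid: "random_bid s v q u = w * (1 - exp (- (s * u)))" for u
    by (simp add: random_bid_def w_def)
  have "(\<integral>\<^sup>+ t. ennreal (g t * indicator {random_bid s v q 0..random_bid s v q 1} t) \<partial>lborel) =
      (\<integral>\<^sup>+ u. ennreal (g (random_bid s v q u) * (s * w * exp (- (s * u))) * indicator {0..1} u) \<partial>lborel)"
  proof (rule nn_integral_substitution)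
    show "(random_bid s v q has_real_derivative s * w * exp (- (s * u))) (at u)" for u
      unfolding bid by (auto intro!: derivative_eq_intros)
  qed (use s w in \<open>auto intro!: continuous_intros simp: set_borel_measurable_def\<close>)
  \<comment> \<open>The bid \<open>b = w * (1 - exp (- (s * u)))\<close> satisfies
    \<open>w - b = w * exp (- (s * u))\<close>.\<close>
  also have "\<dots> = (\<integral>\<^sup>+ u. ennreal s * (ennreal ((w - random_bid s v q u) *
      g (random_bid s v q u)) * indicator {0..1} u) \<partial>lborel)"
    using s by (intro nn_integral_cong)
      (auto simp: bid algebra_simps simp flip: ennreal_mult' split: split_indicator)
  also have "\<dots> = ennreal s * (\<integral>\<^sup>+ u. ennreal ((w - random_bid s v q u) *
      g (random_bid s v q u)) * indicator {0..1} u \<partial>lborel)"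
    by (rule nn_integral_cmult) (simp add: random_bid_def)
  finally have subst: "\<dots> =
      (\<integral>\<^sup>+ t. ennreal (g t * indicator {0..w * (1 - exp (- s))} t) \<partial>lborel)"
    by (simp add: bid)
  have hi: "0 \<le> w * (1 - exp (- s))" using w s by simp
  have "ennreal ((1 - exp (- s)) * v q) = ennreal q * emeasure lborel {0..w * (1 - exp (- s))}"
    using hi by (simp flip: ennreal_mult' w(2) add: mult_ac)
  also have "\<dots> = (\<integral>\<^sup>+ t. ennreal q * indicator {0..w * (1 - exp (- s))} t \<partial>lborel)"
    by (rule nn_integral_cmult_indicator[symmetric]) simp
  \<comment> \<open>Truncated subtraction gives \<open>q = min q c + (q - c)\<close> with
    \<open>c = k - N t\<close>. The excess \<open>q - c\<close> is taken over all \<open>t\<close>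
    from 0 on, a range that is the same for every bidder.\<close>
  also have "\<dots> \<le> (\<integral>\<^sup>+ t. ennreal (g t * indicator {0..w * (1 - exp (- s))} t) +
      ennreal (q - (k - N t)) * indicator {0..} t \<partial>lborel)"
    by (intro nn_integral_mono)
      (auto simp: g_def simp flip: ennreal_plus of_nat_min of_nat_add intro!: ennreal_leI split: split_indicator)
  also have "\<dots> = (\<integral>\<^sup>+ t. ennreal (g t * indicator {0..w * (1 - exp (- s))} t) \<partial>lborel) +
      (\<integral>\<^sup>+ t. ennreal (q - (k - N t)) * indicator {0..} t \<partial>lborel)"
    by (rule nn_integral_add) measurable
  finally show ?thesis
    unfolding subst[symmetric] by (simp add: w_def g_def)
qed simp

section \<open>The equilibrium inequality of a single bidder\<close>

lemma borel_measurable_nn_integral_excess: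
  assumes S: "S \<subseteq> T" "finite S"
  shows "(\<lambda>a. \<integral>\<^sup>+ q. \<integral>\<^sup>+ t. ennreal (q - (k - demand S t a)) * indicator {0..} t
      \<partial>lborel \<partial>measure_pmf Q) \<in> borel_measurable (PiM T (\<lambda>_. action_space m))"
proof -
  let ?M = "PiM T (\<lambda>_. action_space m)"
  note [measurable_cong] = sets_measure_pmf_count_space
  have [measurable]: "(\<lambda>x. demand S (snd x) (fst (fst x))) \<in>
      measurable ((?M \<Otimes>\<^sub>M measure_pmf Q) \<Otimes>\<^sub>M lborel) (count_space UNIV)"
    by (rule measurable_demand[OF S(2) _ _ S(1)]) measurable
  have [measurable]: "(\<lambda>x. indicator {0..} (snd x) :: ennreal) \<in>
      borel_measurable ((?M \<Otimes>\<^sub>M measure_pmf Q) \<Otimes>\<^sub>M (lborel :: real measure))"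
    by (rule measurable_compose[OF measurable_snd]) simp
  have [measurable]: "(\<lambda>x. snd (fst x)) \<in>
      measurable ((?M \<Otimes>\<^sub>M measure_pmf Q) \<Otimes>\<^sub>M (lborel :: real measure)) (count_space UNIV)"
    by measurable
  show ?thesis
    by measurable
qed

text \<open>The equilibrium is compared with \<open>deviation\<close>, which the bound on the mean
  value under \<open>Q\<close> makes feasible. The excess refers to the demand of all bidders, own
  units included, so that one level function serves every bidder in the later sum.\<close>

lemma bidder_bound:
  fixes I :: "('n::finite) auction"
  assumes I: "uniform_price_auction I" and A: "coarse_correlated_equilibrium I A"
    and Q: "set_pmf Q \<subseteq> {..units I}" and s: "0 < s"
    and budget: "enn2ereal (\<integral>\<^sup>+ q. ennreal (val I i q) \<partial>measure_pmf Q) \<le> budget I i"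
  shows "ennreal (1 - exp (- s)) * (\<integral>\<^sup>+ q. ennreal (val I i q) \<partial>measure_pmf Q) \<le>
    ennreal s * (\<integral>\<^sup>+ a. ennreal (val I i (alloc I a i)) \<partial>A) +
    (\<integral>\<^sup>+ a. \<integral>\<^sup>+ q. \<integral>\<^sup>+ t. ennreal (q - (units I - demand UNIV t a)) * indicator {0..} t
      \<partial>lborel \<partial>measure_pmf Q \<partial>A)"
proof -
  let ?k = "units I" and ?v = "val I i" and ?S = "UNIV - {i}"
  define D where "D = deviation s ?v ?k Q"
  let ?O = "others I i A" and ?P = "PiM ?S (\<lambda>_. action_space ?k)"
  note X = I[unfolded uniform_price_auction_def, THEN conjunct2, THEN conjunct1]
  have v: "0 \<le> ?v q" if "q \<le> ?k" for q
    using I that by (rule valuation_nonneg)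
  have v0: "?v 0 = 0"
    using I by (rule valuation_zero)
  have sets_A: "sets A = sets (PiM UNIV (\<lambda>_. action_space ?k))" and "prob_space A"
    using A by (auto simp: coarse_correlated_equilibrium_def space_prob_algebra profile_space_def)
  note [measurable_cong] = sets_A
  interpret A: prob_space A by fact
  have space_A: "space A = space (profile_space ?k)"
    using sets_eq_imp_space_eq[OF sets_A] by (simp add: profile_space_def)
  have D: "D \<in> space (prob_algebra (action_space ?k))"
    unfolding D_def by (rule deviation_in_prob_algebra)
  then have sets_D: "sets D = sets (action_space ?k)" and "prob_space D"
    by (auto simp: space_prob_algebra)
  note [measurable_cong] = sets_D
  interpret D: prob_space D by fact
  have restr [measurable]: "(\<lambda>a. restrict a ?S) \<in> measurable A ?P"
    by (rule measurable_restrict) measurable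
  have sets_O: "sets ?O = sets ?P"
    by (simp add: others_def)
  note [measurable_cong] = sets_O
  interpret O: prob_space ?O
    unfolding others_def by (rule A.prob_space_distr) measurable
  interpret DO: pair_prob_space D ?O ..
  have AE_D: "AE x in D \<Otimes>\<^sub>M ?O. fst (fst x) * real (snd (fst x)) \<le> ?v (snd (fst x))"
  proof -
    have "{x \<in> space (D \<Otimes>\<^sub>M ?O). fst (fst x) * real (snd (fst x)) \<le> ?v (snd (fst x))} \<in>
        sets (D \<Otimes>\<^sub>M ?O)"
      by measurable
    moreover have "AE d in D. fst d * real (snd d) \<le> ?v (snd d)"
      unfolding D_def by (rule AE_deviation) (use s v in auto)
    ultimately show ?thesis
      by (intro DO.AE_pair_measure) auto
  qed
  have profile: "a(i := d) \<in> space (profile_space ?k)" if "(d, a) \<in> space (D \<Otimes>\<^sub>M ?O)" for d a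
  proof -
    have "space D = {0..} \<times> {..?k}" "space ?O = PiE ?S (\<lambda>_. {0..} \<times> {..?k})"
      using sets_eq_imp_space_eq[OF sets_D] sets_eq_imp_space_eq[OF sets_O]
      by (simp_all add: space_action_space space_PiM)
    then have "d \<in> {0..} \<times> {..?k}" and a: "a \<in> PiE ?S (\<lambda>_. {0..} \<times> {..?k})"
      using that by (simp_all add: space_pair_measure)
    moreover have "a j \<in> {0..} \<times> {..?k}" if "j \<noteq> i" for j
      using a that by (intro PiE_mem[OF a]) simp
    ultimately show ?thesis
      by (auto simp: space_profile_space mem_Times_iff)
  qed
  \<comment> \<open>The demand of the rivals ignores the entry at \<open>i\<close>, so it may be
    read off the deviation profile, the restricted profile or the equilibrium profile alike.\<close>
  have demand_upd: "demand ?S t (a(i := d)) = demand ?S t a" for t d and a :: "'n profile"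
    unfolding demand_def by (rule sum.cong) auto
  have demand_restr: "demand ?S t (restrict a ?S) = demand ?S t a" for t and a :: "'n profile"
    unfolding demand_def by (rule sum.cong) auto
  \<comment> \<open>\<open>h\<close> is the lower bound from \<open>utility_ge\<close>. It does not
    involve the allocation rule and is jointly measurable, as the exchange of the integrals
    requires.\<close>
  define h where "h d a = ennreal ((?v (snd d) / snd d - fst d) *
    min (snd d) (?k - demand ?S (fst d) a))" for d and a :: "'n profile"
  have [measurable]: "(\<lambda>x. demand ?S (fst (fst x)) (snd x)) \<in>
      measurable (action_space ?k \<Otimes>\<^sub>M ?P) (count_space UNIV)"
    by (rule measurable_demand[where T = ?S]) auto
  have h [measurable]: "(\<lambda>(d, a). h d a) \<in> borel_measurable (action_space ?k \<Otimes>\<^sub>M ?P)"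
    unfolding h_def by measurable

  \<comment> \<open>The payment is at most the bid times the units won, hence at most the value of
    the demanded quantity, whose mean under \<open>Q\<close> is within the budget.\<close>
  have "D \<in> feasible_deviations I i A"
  proof -
    have "dev_expect I i D A (payment I i) =
        enn2ereal (\<integral>\<^sup>+ x. ennreal (payment I i ((snd x)(i := fst x))) \<partial>(D \<Otimes>\<^sub>M ?O))"
      unfolding dev_expect_def split_beta'
      by (rule expect_nonneg) (use payment_nonneg[OF profile] in \<open>auto intro!: AE_I2\<close>)
    also have "\<dots> \<le> enn2ereal (\<integral>\<^sup>+ x. ennreal (?v (snd (fst x))) \<partial>(D \<Otimes>\<^sub>M ?O))"
      unfolding less_eq_ennreal.rep_eq[symmetric]
    proof (rule nn_integral_mono_AE, use AE_D AE_space in eventually_elim)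
      fix x assume x: "fst (fst x) * real (snd (fst x)) \<le> ?v (snd (fst x))" "x \<in> space (D \<Otimes>\<^sub>M ?O)"
      let ?a = "(snd x)(i := fst x)"
      have a: "?a \<in> space (profile_space ?k)"
        using x by (intro profile) simp
      have "payment I i ?a \<le> fst (?a i) * alloc I ?a i"
        by (rule payment_le[OF X a])
      also have "\<dots> \<le> fst (?a i) * snd (?a i)"
        using a alloc_le_quantity[OF X a, of i]
        by (intro mult_left_mono) (auto simp: space_profile_space dest: spec[of _ i])
      finally show "ennreal (payment I i ?a) \<le> ennreal (?v (snd (fst x)))"
        using x by (intro ennreal_leI) simp
    qed
    also have "(\<integral>\<^sup>+ x. ennreal (?v (snd (fst x))) \<partial>(D \<Otimes>\<^sub>M ?O)) =
        (\<integral>\<^sup>+ d. \<integral>\<^sup>+ a. ennreal (?v (snd d)) \<partial>?O \<partial>D)"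
      by (subst O.nn_integral_fst[symmetric]) auto
    also have "\<dots> = (\<integral>\<^sup>+ q. ennreal (?v q) \<partial>measure_pmf Q)"
      using s v Q by (simp add: O.emeasure_space_1 D_def nn_integral_deviation nn_integral_cmult_indicator)
    also have "enn2ereal \<dots> \<le> budget I i" by (rule budget)
    finally show ?thesis
      using D by (simp add: feasible_deviations_def)
  qed
  then have "dev_expect I i D A (utility I i) \<le> expect A (utility I i)"
    using A by (simp add: coarse_correlated_equilibrium_def)
  also have "\<dots> \<le> enn2ereal (\<integral>\<^sup>+ a. ennreal (?v (alloc I a i)) \<partial>A)"
    by (rule expect_le) (use payment_nonneg in \<open>auto simp: utility_def space_A\<close>)
  finally have upper: "dev_expect I i D A (utility I i) \<le> \<dots>" .

  have AE_util: "AE x in D \<Otimes>\<^sub>M ?O. h (fst x) (snd x) \<le> ennreal (utility I i ((snd x)(i := fst x))) \<and>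
      0 \<le> utility I i ((snd x)(i := fst x))"
    using AE_D AE_space
  proof eventually_elim
    fix x assume x: "fst (fst x) * real (snd (fst x)) \<le> ?v (snd (fst x))" "x \<in> space (D \<Otimes>\<^sub>M ?O)"
    let ?a = "(snd x)(i := fst x)"
    have a: "?a \<in> space (profile_space ?k)"
      using x by (intro profile) simp
    have le: "(?v (snd (fst x)) / snd (fst x) - fst (fst x)) *
        min (snd (fst x)) (?k - demand ?S (fst (fst x)) (snd x)) \<le> utility I i ?a"
      using utility_ge[OF I a, of i "fst (fst x)" "snd (fst x)"] x(1) by (simp only: demand_upd) simp
    moreover have "0 \<le> (?v (snd (fst x)) / snd (fst x) - fst (fst x)) *
        min (snd (fst x)) (?k - demand ?S (fst (fst x)) (snd x))"
    proof (cases "snd (fst x) = 0")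
      case False
      then have "fst (fst x) \<le> ?v (snd (fst x)) / snd (fst x)"
        using x(1) by (simp add: pos_le_divide_eq)
      then show ?thesis
        by (intro mult_nonneg_nonneg) simp_all
    qed simp
    ultimately show "h (fst x) (snd x) \<le> ennreal (utility I i ?a) \<and> 0 \<le> utility I i ?a"
      unfolding h_def by (auto intro!: ennreal_leI)
  qed
  have "(\<integral>\<^sup>+ x. h (fst x) (snd x) \<partial>(D \<Otimes>\<^sub>M ?O)) \<le>
      (\<integral>\<^sup>+ x. ennreal (utility I i ((snd x)(i := fst x))) \<partial>(D \<Otimes>\<^sub>M ?O))"
    by (rule nn_integral_mono_AE) (use AE_util in auto)
  also have "enn2ereal \<dots> = dev_expect I i D A (utility I i)"
    unfolding dev_expect_def split_beta'
    by (rule expect_nonneg[symmetric]) (use AE_util in auto)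
  ultimately have "(\<integral>\<^sup>+ x. h (fst x) (snd x) \<partial>(D \<Otimes>\<^sub>M ?O)) \<le>
      (\<integral>\<^sup>+ a. ennreal (?v (alloc I a i)) \<partial>A)"
    using upper by (simp add: less_eq_ennreal.rep_eq)
  moreover have "(\<integral>\<^sup>+ x. h (fst x) (snd x) \<partial>(D \<Otimes>\<^sub>M ?O)) =
      (\<integral>\<^sup>+ a. \<integral>\<^sup>+ d. h d a \<partial>D \<partial>?O)"
    by (subst DO.nn_integral_snd[symmetric]) auto
  moreover have "\<dots> = (\<integral>\<^sup>+ a. \<integral>\<^sup>+ d. h d (restrict a ?S) \<partial>D \<partial>A)"
    unfolding others_def by (rule nn_integral_distr) measurable
  ultimately have gain: "(\<integral>\<^sup>+ a. \<integral>\<^sup>+ d. h d (restrict a ?S) \<partial>D \<partial>A) \<le>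
      (\<integral>\<^sup>+ a. ennreal (?v (alloc I a i)) \<partial>A)" by simp

  let ?R = "\<lambda>S a. \<integral>\<^sup>+ q. \<integral>\<^sup>+ t. ennreal (q - (?k - demand S t a)) * indicator {0..} t
      \<partial>lborel \<partial>measure_pmf Q"
  have [measurable]: "?R S \<in> borel_measurable A" for S
    using borel_measurable_nn_integral_excess[where S = S and T = UNIV and k = ?k and Q = Q and m = ?k] by simp
  \<comment> \<open>For a fixed equilibrium profile, the demand of the rivals plays the role of
    \<open>N\<close> in \<open>nn_integral_random_bid\<close>; the bound is then averaged over
    \<open>q\<close>.\<close>
  have "ennreal (1 - exp (- s)) * (\<integral>\<^sup>+ q. ennreal (?v q) \<partial>measure_pmf Q) \<le>
      ennreal s * (\<integral>\<^sup>+ d. h d (restrict a ?S) \<partial>D) + ?R UNIV a" if a: "a \<in> space A" for a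
  proof -
    have ra: "restrict a ?S \<in> space ?P"
      using measurable_space[OF restr a] .
    have dem [measurable]: "(\<lambda>t. demand ?S t a) \<in> measurable borel (count_space UNIV)"
    proof -
      have "(\<lambda>t. demand ?S t (restrict a ?S)) \<in> measurable borel (count_space UNIV)"
        by (rule measurable_demand[where T = ?S and k = ?k]) (use ra in auto)
      then show ?thesis by (simp only: demand_restr)
    qed
    have "(\<integral>\<^sup>+ d. h d (restrict a ?S) \<partial>D) = (\<integral>\<^sup>+ q. \<integral>\<^sup>+ u.
        h (random_bid s ?v q u, q) (restrict a ?S) * indicator {0..1} u \<partial>lborel \<partial>measure_pmf Q)"
      unfolding D_def
    proof (rule nn_integral_deviation)
      show "(\<lambda>d. h d (restrict a ?S)) \<in> borel_measurable (action_space ?k)"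
        using measurable_compose[OF measurable_Pair2'[OF ra] h] by simp
    qed (use s v Q in auto)
    note h_eq = this
    have "ennreal (1 - exp (- s)) * (\<integral>\<^sup>+ q. ennreal (?v q) \<partial>measure_pmf Q) =
        (\<integral>\<^sup>+ q. ennreal ((1 - exp (- s)) * ?v q) \<partial>measure_pmf Q)"
      using s by (simp add: ennreal_mult' nn_integral_cmult)
    also have "\<dots> \<le> (\<integral>\<^sup>+ q. ennreal s * (\<integral>\<^sup>+ u. h (random_bid s ?v q u, q) (restrict a ?S) *
        indicator {0..1} u \<partial>lborel) +
        (\<integral>\<^sup>+ t. ennreal (q - (?k - demand ?S t a)) * indicator {0..} t \<partial>lborel) \<partial>measure_pmf Q)"
    proof (rule nn_integral_mono_AE, unfold AE_measure_pmf_iff, intro ballI)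
      fix q assume "q \<in> set_pmf Q"
      then have "q \<le> ?k" using Q by auto
      then show "ennreal ((1 - exp (- s)) * ?v q) \<le>
          ennreal s * (\<integral>\<^sup>+ u. h (random_bid s ?v q u, q) (restrict a ?S) * indicator {0..1} u \<partial>lborel) +
          (\<integral>\<^sup>+ t. ennreal (q - (?k - demand ?S t a)) * indicator {0..} t \<partial>lborel)"
        using nn_integral_random_bid[OF dem s, of ?v q ?k] v v0
        by (simp add: h_def demand_restr)
    qed
    also have "\<dots> = ennreal s * (\<integral>\<^sup>+ d. h d (restrict a ?S) \<partial>D) + ?R ?S a"
      by (simp add: nn_integral_add nn_integral_cmult h_eq)
    \<comment> \<open>Adding the bidder's own demand can only raise the excess.\<close>
    also have "\<dots> \<le> ennreal s * (\<integral>\<^sup>+ d. h d (restrict a ?S) \<partial>D) + ?R UNIV a"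
      by (intro add_left_mono nn_integral_mono mult_right_mono ennreal_leI of_nat_mono diff_le_mono2
          demand_mono) auto
    finally show ?thesis .
  qed
  then have "(\<integral>\<^sup>+ a. ennreal (1 - exp (- s)) * (\<integral>\<^sup>+ q. ennreal (?v q) \<partial>measure_pmf Q) \<partial>A) \<le>
      (\<integral>\<^sup>+ a. ennreal s * (\<integral>\<^sup>+ d. h d (restrict a ?S) \<partial>D) + ?R UNIV a \<partial>A)"
    by (intro nn_integral_mono) auto
  also have "\<dots> = ennreal s * (\<integral>\<^sup>+ a. \<integral>\<^sup>+ d. h d (restrict a ?S) \<partial>D \<partial>A) + (\<integral>\<^sup>+ a. ?R UNIV a \<partial>A)"
    by (subst nn_integral_add) (auto simp: nn_integral_cmult)
  also have "\<dots> \<le> ennreal s * (\<integral>\<^sup>+ a. ennreal (?v (alloc I a i)) \<partial>A) + (\<integral>\<^sup>+ a. ?R UNIV a \<partial>A)"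
    by (intro add_right_mono mult_left_mono gain) simp
  finally show ?thesis
    by (simp add: A.emeasure_space_1)
qed

section \<open>The optimal constant\<close>

text \<open>Setting the derivative of \<open>(1 + s) / (1 - exp (- s))\<close> to 0 gives
  \<open>exp s = 2 + s\<close>, where the ratio equals \<open>2 + s\<close>. Then
  \<open>w = - (2 + s)\<close> satisfies
  \<open>w * exp w = - exp (s - (2 + s)) = - exp (- 2)\<close>.\<close>

lemma lambert_Wm1_root:
  obtains s :: real where "0 < s" "exp s = 2 + s" "lambert_Wm1 (- exp (- 2)) = - (2 + s)"
proof -
  have e1: "exp 1 \<le> (3 :: real)"
    by (rule exp_le)
  have e2: "4 \<le> exp (2 :: real)"
    using exp_lower_Taylor_quadratic[of "2 :: real"] by simp
  \<comment> \<open>The endpoints satisfy \<open>exp 1 - 1 <= 2 <= exp 2 - 2\<close>.\<close>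
  have "\<exists>s::real. 1 \<le> s \<and> s \<le> 2 \<and> exp s - s = 2"
    by (rule IVT) (use e1 e2 in \<open>auto intro!: continuous_intros\<close>)
  then obtain s :: real where s: "1 \<le> s" "exp s = 2 + s"
    by auto
  have root: "- (2 + s) * exp (- (2 + s)) = - exp (- 2)"
  proof -
    have "(2 + s) * exp (- (2 + s)) = exp (s + - (2 + s))"
      unfolding exp_add s(2) ..
    also have "s + - (2 + s) = - 2"
      by simp
    finally show ?thesis
      by (simp only: mult_minus_left)
  qed
  \<comment> \<open>The derivative \<open>(1 + x) * exp x\<close> is negative for
    \<open>x < -1\<close>, so the lower branch has only one root.\<close>
  have decr: "w * exp w < w' * exp w'" if "w' < w" "w \<le> -1" for w w' :: real
  proof (rule DERIV_neg_imp_decreasing_open[OF that(1)])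
    fix x assume "w' < x" "x < w"
    then have "(1 + x) * exp x < 0"
      using that by (intro mult_neg_pos) auto
    moreover have "((\<lambda>x. x * exp x) has_real_derivative (1 + x) * exp x) (at x)"
      by (auto intro!: derivative_eq_intros simp: algebra_simps)
    ultimately show "\<exists>y. ((\<lambda>x. x * exp x) has_real_derivative y) (at x) \<and> y < 0"
      by blast
  qed (intro continuous_intros)
  have "lambert_Wm1 (- exp (- 2)) = - (2 + s)"
    unfolding lambert_Wm1_def
  proof (rule the_equality)
    fix w :: real assume w: "w \<le> -1 \<and> w * exp w = - exp (- 2)"
    then show "w = - (2 + s)"
      using decr[of w "- (2 + s)"] decr[of "- (2 + s)" w] s root
      by (cases w "- (2 + s)" rule: linorder_cases) auto
  qed (use s root in auto)
  then show thesis
    using that[of s] s by simp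
qed

section \<open>Thinning to the budget and summation over the bidders\<close>

text \<open>Following \<open>P\<close> only with some probability, and demanding 0 otherwise, scales
  the integral of every \<open>g\<close> with \<open>g 0 = 0\<close> by that probability. The value
  can thus be lowered to exactly \<open>B\<close>. The last property is meant for the
  excess.\<close>

lemma thinning:
  fixes P :: "nat pmf" and B :: ereal
  assumes v0: "v 0 = 0" and fin: "(\<integral>\<^sup>+ q. ennreal (v q) \<partial>measure_pmf P) < \<top>" and B: "0 < B"
  obtains Q where "set_pmf Q \<subseteq> insert 0 (set_pmf P)"
    "enn2ereal (\<integral>\<^sup>+ q. ennreal (v q) \<partial>measure_pmf Q) =
      min (enn2ereal (\<integral>\<^sup>+ q. ennreal (v q) \<partial>measure_pmf P)) B"
    "\<And>g. g 0 = 0 \<Longrightarrow> (\<integral>\<^sup>+ q. g q \<partial>measure_pmf Q) \<le> (\<integral>\<^sup>+ q. g q \<partial>measure_pmf P)"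
proof (cases "enn2ereal (\<integral>\<^sup>+ q. ennreal (v q) \<partial>measure_pmf P) \<le> B")
  case True
  show thesis
    by (rule that[of P]) (use True in \<open>auto simp: min_def\<close>)
next
  case False
  obtain e where e: "0 \<le> e" "(\<integral>\<^sup>+ q. ennreal (v q) \<partial>measure_pmf P) = ennreal e"
    using fin by (metis ennreal_cases less_irrefl)
  obtain b where b: "B = ereal b" "0 < b" "b < e"
    using False B e by (cases B) auto
  \<comment> \<open>The probability \<open>b / e\<close> brings the expected value from
    \<open>e\<close> down to the budget \<open>b\<close>, which is finite here since an infinite one
    belongs to the first case.\<close>
  define Q where "Q = bind_pmf (bernoulli_pmf (b / e)) (\<lambda>c. if c then P else return_pmf 0)"
  have Q: "(\<integral>\<^sup>+ q. g q \<partial>measure_pmf Q) = (\<integral>\<^sup>+ q. g q \<partial>measure_pmf P) * ennreal (b / e)"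
    if "g 0 = 0" for g :: "nat \<Rightarrow> ennreal"
    using that b by (simp add: Q_def)
  show thesis
  proof (rule that[of Q])
    show "set_pmf Q \<subseteq> insert 0 (set_pmf P)"
      by (auto simp: Q_def split: if_splits)
    have "(\<integral>\<^sup>+ q. ennreal (v q) \<partial>measure_pmf Q) = ennreal b"
      using Q[of "\<lambda>q. ennreal (v q)"] v0 e b by (simp flip: ennreal_mult')
    then show "enn2ereal (\<integral>\<^sup>+ q. ennreal (v q) \<partial>measure_pmf Q) =
        min (enn2ereal (\<integral>\<^sup>+ q. ennreal (v q) \<partial>measure_pmf P)) B"
      using e b by (simp add: min_def)
    show "(\<integral>\<^sup>+ q. g q \<partial>measure_pmf Q) \<le> (\<integral>\<^sup>+ q. g q \<partial>measure_pmf P)"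
      if "g 0 = 0" for g
    proof -
      have "ennreal (b / e) \<le> 1" using b by simp
      from mult_left_mono[OF this, of "\<integral>\<^sup>+ q. g q \<partial>measure_pmf P"] show ?thesis
        using that by (simp add: Q)
    qed
  qed
qed

text \<open>At each level \<open>t\<close> the excesses add up to at most the number of units won
  with bids of at least \<open>t\<close>. Over all levels, a winning unit is counted for each
  \<open>t\<close> between 0 and its bid, so it contributes that bid.\<close>

lemma sum_excess_integral_le:
  fixes x :: "'n::finite \<Rightarrow> nat"
  assumes X: "allocation_rule k X" and a: "a \<in> space (profile_space k)"
    and x: "(\<Sum>i\<in>UNIV. x i) \<le> k"
  shows "(\<Sum>i\<in>UNIV. \<integral>\<^sup>+ t. ennreal (x i - (k - demand UNIV t a)) * indicator {0..} t \<partial>lborel) \<le>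
    (\<Sum>i\<in>UNIV. ennreal (fst (a i) * X a i))"
proof -
  have [measurable]: "(\<lambda>t. demand UNIV t a) \<in> measurable borel (count_space UNIV)"
    by (rule measurable_demand[where T = UNIV and k = k]) (use a in \<open>auto simp: profile_space_def\<close>)
  have "(\<Sum>i\<in>UNIV. \<integral>\<^sup>+ t. ennreal (x i - (k - demand UNIV t a)) * indicator {0..} t \<partial>lborel) =
      (\<integral>\<^sup>+ t. (\<Sum>i\<in>UNIV. ennreal (x i - (k - demand UNIV t a)) * indicator {0..} t) \<partial>lborel)"
    by (rule nn_integral_sum[symmetric]) measurable
  also have "\<dots> \<le> (\<integral>\<^sup>+ t. (\<Sum>i\<in>UNIV. ennreal (X a i) * indicator {0..fst (a i)} t) \<partial>lborel)"
  proof (rule nn_integral_mono)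
    fix t :: real
    show "(\<Sum>i\<in>UNIV. ennreal (x i - (k - demand UNIV t a)) * indicator {0..} t) \<le>
        (\<Sum>i\<in>UNIV. ennreal (X a i) * indicator {0..fst (a i)} t)"
    proof (cases "0 \<le> t")
      case True
      have "(\<Sum>i\<in>UNIV. x i - (k - demand UNIV t a)) \<le>
          (\<Sum>i\<in>UNIV. if t \<le> fst (a i) then X a i else 0)"
        unfolding sum_winners_above[OF X a] by (rule sum_excess_le) (use x in auto)
      then have "ennreal (\<Sum>i\<in>UNIV. x i - (k - demand UNIV t a)) \<le>
          ennreal (\<Sum>i\<in>UNIV. if t \<le> fst (a i) then X a i else 0)"
        by (intro ennreal_leI of_nat_mono)
      also have "\<dots> = (\<Sum>i\<in>UNIV. ennreal (X a i) * indicator {0..fst (a i)} t)"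
        unfolding of_nat_sum using True
        by (subst sum_ennreal[symmetric], simp) (intro sum.cong refl, simp split: split_indicator)
      finally show ?thesis
        using True by (simp add: sum_ennreal)
    qed simp
  qed
  also have "\<dots> = (\<Sum>i\<in>UNIV. \<integral>\<^sup>+ t. ennreal (X a i) * indicator {0..fst (a i)} t \<partial>lborel)"
    by (rule nn_integral_sum) measurable
  also have "\<dots> = (\<Sum>i\<in>UNIV. ennreal (fst (a i) * X a i))"
    using a by (intro sum.cong)
      (auto simp: space_profile_space nn_integral_cmult_indicator mult_ac simp flip: ennreal_mult')
  finally show ?thesis .
qed

theorem theorem5p3:
  fixes I :: "('n::finite) auction" and A :: "'n profile measure"
  assumes "2 \<le> CARD('n)"
    and "uniform_price_auction I"
    and "coarse_correlated_equilibrium I A"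
    and "nob_feasible I A"
  shows "opt I \<le> ereal (- lambert_Wm1 (- exp (- 2))) * liquid_welfare I A"
proof -
  let ?k = "units I"
  note X = assms(2)[unfolded uniform_price_auction_def, THEN conjunct2, THEN conjunct1]
  have v: "0 \<le> val I i q" if "q \<le> ?k" for i q
    using assms(2) that by (rule valuation_nonneg)
  have v0: "val I i 0 = 0" for i
    using assms(2) by (rule valuation_zero)
  have B: "0 < budget I i" for i
    using assms(2) by (simp add: uniform_price_auction_def)
  have sets_A: "sets A = sets (PiM UNIV (\<lambda>_. action_space ?k))"
    using assms(3) by (simp add: coarse_correlated_equilibrium_def space_prob_algebra profile_space_def)
  note [measurable_cong] = sets_A
  have space_A: "space A = space (profile_space ?k)"
    using sets_eq_imp_space_eq[OF sets_A] by (simp add: profile_space_def)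
  have alloc_le: "alloc I a i \<le> ?k" if "a \<in> space A" for a i
    using alloc_le_quantity[OF X, of a i] that by (auto simp: space_A space_profile_space intro: order_trans)
  have alloc_meas [measurable]: "(\<lambda>a. alloc I a i) \<in> measurable A (count_space UNIV)" for i
    using X by (simp add: allocation_rule_def profile_space_def measurable_cong_sets[OF sets_A refl])

  define V where "V i = (\<integral>\<^sup>+ a. ennreal (val I i (alloc I a i)) \<partial>A)" for i
  \<comment> \<open>The welfare terms are moved to \<open>ennreal\<close> for the arithmetic of the
    sums; as budgets are positive, nothing is cut off at 0.\<close>
  define L where "L i = e2ennreal (min (enn2ereal (V i)) (budget I i))" for i
  have L: "enn2ereal (L i) = min (enn2ereal (V i)) (budget I i)" for i
    unfolding L_def by (rule enn2ereal_e2ennreal) (use B[of i] in auto)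
  have LW: "liquid_welfare I A = enn2ereal (\<Sum>i\<in>UNIV. L i)"
    unfolding liquid_welfare_def sum_enn2ereal[OF zero_le, symmetric] L V_def
    by (intro sum.cong refl arg_cong2[where f = min] expect_nonneg AE_I2 v alloc_le)

  \<comment> \<open>No-overbidding enters here, through \<open>max_payment_ge\<close>.\<close>
  have bids_le: "(\<Sum>i\<in>UNIV. \<integral>\<^sup>+ a. ennreal (fst (a i) * alloc I a i) \<partial>A) \<le> (\<Sum>i\<in>UNIV. L i)"
  proof -
    have "enn2ereal (\<integral>\<^sup>+ a. ennreal (fst (a i) * alloc I a i) \<partial>A) \<le> expect A (max_payment I i)" for i
    proof -
      have le: "fst (a i) * alloc I a i \<le> max_payment I i a" if "a \<in> space A" for a
        using max_payment_ge[OF assms(1) X] that by (simp add: space_A)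
      have "0 \<le> max_payment I i a" if "a \<in> space A" for a
        using le[OF that] that by (auto simp: space_A space_profile_space intro: order_trans[rotated])
      then have "expect A (max_payment I i) = enn2ereal (\<integral>\<^sup>+ a. ennreal (max_payment I i a) \<partial>A)"
        by (intro expect_nonneg AE_I2)
      then show ?thesis
        unfolding less_eq_ennreal.rep_eq[symmetric]
        by (simp add: less_eq_ennreal.rep_eq[symmetric] nn_integral_mono ennreal_leI le)
    qed
    then have "enn2ereal (\<Sum>i\<in>UNIV. \<integral>\<^sup>+ a. ennreal (fst (a i) * alloc I a i) \<partial>A) \<le>
        (\<Sum>i\<in>UNIV. expect A (max_payment I i))"
      unfolding sum_enn2ereal[OF zero_le, symmetric] by (intro sum_mono)
    also have "\<dots> \<le> enn2ereal (\<Sum>i\<in>UNIV. L i)"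
      using assms(4) by (simp add: nob_feasible_def LW)
    finally show ?thesis
      by (simp add: less_eq_ennreal.rep_eq)
  qed

  obtain s where s: "0 < s" "exp s = 2 + s" "lambert_Wm1 (- exp (- 2)) = - (2 + s)"
    by (rule lambert_Wm1_root)
  \<comment> \<open>The choice of \<open>s\<close> gives \<open>exp (- s) = 1 / (2 + s)\<close>. The
    inequality with \<open>s\<close> serves the bidders limited by their budgets.\<close>
  have hi: "0 < 1 - exp (- s)" "1 - exp (- s) \<le> s" "(1 - exp (- s)) * (2 + s) = s + 1"
    using s exp_ge_add_one_self[of "- s"] by (auto simp: exp_minus field_simps)

  show ?thesis
    unfolding opt_def
  proof (rule SUP_least)
    fix p assume "p \<in> {p. set_pmf p \<subseteq> feasible_allocations I}"
    then have p: "\<And>x i. x \<in> set_pmf p \<Longrightarrow> x i \<le> ?k" "\<And>x. x \<in> set_pmf p \<Longrightarrow> (\<Sum>i\<in>UNIV. x i) \<le> ?k"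
      by (auto simp: feasible_allocations_def)
    define P where "P i = map_pmf (\<lambda>x. x i) p" for i
    have P_supp: "set_pmf (P i) \<subseteq> {..?k}" for i
      using p(1) by (auto simp: P_def)
    have P_fin: "(\<integral>\<^sup>+ q. ennreal (val I i q) \<partial>measure_pmf (P i)) < \<top>" for i
    proof -
      have "finite (set_pmf (P i))"
        by (rule finite_subset[OF P_supp]) simp
      then show ?thesis
        by (simp add: nn_integral_measure_pmf_finite ennreal_mult_less_top)
    qed
    have "\<forall>i. \<exists>Q. set_pmf Q \<subseteq> insert 0 (set_pmf (P i)) \<and>
        enn2ereal (\<integral>\<^sup>+ q. ennreal (val I i q) \<partial>measure_pmf Q) =
          min (enn2ereal (\<integral>\<^sup>+ q. ennreal (val I i q) \<partial>measure_pmf (P i))) (budget I i) \<and>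
        (\<forall>g. g 0 = 0 \<longrightarrow> (\<integral>\<^sup>+ q. g q \<partial>measure_pmf Q) \<le> (\<integral>\<^sup>+ q. g q \<partial>measure_pmf (P i)))"
      using thinning[OF v0 P_fin B] by (metis (no_types))
    then obtain Q where Q_supp: "\<And>i. set_pmf (Q i) \<subseteq> insert 0 (set_pmf (P i))"
      and Q_val: "\<And>i. enn2ereal (\<integral>\<^sup>+ q. ennreal (val I i q) \<partial>measure_pmf (Q i)) =
          min (enn2ereal (\<integral>\<^sup>+ q. ennreal (val I i q) \<partial>measure_pmf (P i))) (budget I i)"
      and Q_le: "\<And>i g. g 0 = 0 \<Longrightarrow>
          (\<integral>\<^sup>+ q. g q \<partial>measure_pmf (Q i)) \<le> (\<integral>\<^sup>+ q. g q \<partial>measure_pmf (P i))"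
      by metis
    define G where "G i = (\<integral>\<^sup>+ q. ennreal (val I i q) \<partial>measure_pmf (Q i))" for i
    define R where "R D = (\<integral>\<^sup>+ a. \<integral>\<^sup>+ q. \<integral>\<^sup>+ t. ennreal (q - (?k - demand UNIV t a)) *
        indicator {0..} t \<partial>lborel \<partial>measure_pmf D \<partial>A)" for D
    have bound: "ennreal (1 - exp (- s)) * G i \<le> ennreal s * L i + R (P i)" for i
    proof (cases "enn2ereal (V i) \<le> budget I i")
      case True
      then have "L i = V i"
        by (simp add: L_def min_def)
      then have "ennreal (1 - exp (- s)) * G i \<le> ennreal s * L i + R (Q i)"
        unfolding G_def R_def V_def
        using Q_supp[of i] P_supp[of i] Q_val[of i] s(1)
        by (auto intro!: bidder_bound assms)
      \<comment> \<open>The excess vanishes at \<open>q = 0\<close>, so thinning cannot raise it.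
        Returning to \<open>P i\<close> matters because these are the marginals of one feasible
        lottery \<open>p\<close>.\<close>
      also have "R (Q i) \<le> R (P i)"
        unfolding R_def by (intro nn_integral_mono Q_le) simp
      finally show ?thesis
        by (simp add: add_left_mono)
    next
      case False
      \<comment> \<open>Here \<open>L i\<close> is the budget, which the thinned value
        \<open>G i\<close> never exceeds.\<close>
      then have "enn2ereal (G i) \<le> enn2ereal (L i)"
        unfolding L G_def Q_val by (auto simp: min_def)
      then have "ennreal (1 - exp (- s)) * G i \<le> ennreal s * L i"
        unfolding less_eq_ennreal.rep_eq[symmetric] using hi by (intro mult_mono ennreal_leI) auto
      then show ?thesis
        by (rule order_trans) simp
    qed
    have "(\<Sum>i\<in>UNIV. R (P i)) = (\<integral>\<^sup>+ a. (\<Sum>i\<in>UNIV. \<integral>\<^sup>+ q. \<integral>\<^sup>+ t.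
        ennreal (q - (?k - demand UNIV t a)) * indicator {0..} t \<partial>lborel \<partial>measure_pmf (P i)) \<partial>A)"
      unfolding R_def
      by (rule nn_integral_sum[symmetric])
        (simp add: borel_measurable_nn_integral_excess measurable_cong_sets[OF sets_A refl])
    also have "\<dots> \<le> (\<integral>\<^sup>+ a. (\<Sum>i\<in>UNIV. ennreal (fst (a i) * alloc I a i)) \<partial>A)"
    proof (rule nn_integral_mono)
      fix a assume "a \<in> space A"
      then have a: "a \<in> space (profile_space ?k)" by (simp add: space_A)
      \<comment> \<open>The marginals are put back together, so that feasibility applies to each
        allocation drawn from \<open>p\<close>.\<close>
      have "(\<Sum>i\<in>UNIV. \<integral>\<^sup>+ q. \<integral>\<^sup>+ t. ennreal (q - (?k - demand UNIV t a)) *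
          indicator {0..} t \<partial>lborel \<partial>measure_pmf (P i)) =
          (\<integral>\<^sup>+ x. (\<Sum>i\<in>UNIV. \<integral>\<^sup>+ t. ennreal (x i - (?k - demand UNIV t a)) *
          indicator {0..} t \<partial>lborel) \<partial>measure_pmf p)"
        by (simp add: P_def nn_integral_sum)
      also have "\<dots> \<le> (\<integral>\<^sup>+ x. (\<Sum>i\<in>UNIV. ennreal (fst (a i) * alloc I a i)) \<partial>measure_pmf p)"
        by (rule nn_integral_mono_AE)
          (use p(2) in \<open>auto simp: AE_measure_pmf_iff intro!: sum_excess_integral_le[OF X a]\<close>)
      finally show "(\<Sum>i\<in>UNIV. \<integral>\<^sup>+ q. \<integral>\<^sup>+ t. ennreal (q - (?k - demand UNIV t a)) *
          indicator {0..} t \<partial>lborel \<partial>measure_pmf (P i)) \<le>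
          (\<Sum>i\<in>UNIV. ennreal (fst (a i) * alloc I a i))"
        by simp
    qed
    also have "\<dots> = (\<Sum>i\<in>UNIV. \<integral>\<^sup>+ a. ennreal (fst (a i) * alloc I a i) \<partial>A)"
      by (rule nn_integral_sum) measurable
    also note bids_le
    finally have R_le: "(\<Sum>i\<in>UNIV. R (P i)) \<le> (\<Sum>i\<in>UNIV. L i)" .
    have "ennreal (1 - exp (- s)) * (\<Sum>i\<in>UNIV. G i) \<le> (\<Sum>i\<in>UNIV. ennreal s * L i + R (P i))"
      unfolding sum_distrib_left by (intro sum_mono bound)
    also have "\<dots> = ennreal s * (\<Sum>i\<in>UNIV. L i) + (\<Sum>i\<in>UNIV. R (P i))"
      by (simp add: sum.distrib sum_distrib_left)
    also have "\<dots> \<le> ennreal s * (\<Sum>i\<in>UNIV. L i) + ennreal 1 * (\<Sum>i\<in>UNIV. L i)"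
      using R_le by (simp add: add_left_mono)
    also have "\<dots> = ennreal (s + 1) * (\<Sum>i\<in>UNIV. L i)"
      using s(1) by (simp add: ennreal_plus distrib_right del: ennreal_1)
    also have "ennreal (s + 1) = ennreal (1 - exp (- s)) * ennreal (2 + s)"
      unfolding hi(3)[symmetric] by (rule ennreal_mult) (use hi s(1) in auto)
    finally have "ennreal (1 - exp (- s)) * (\<Sum>i\<in>UNIV. G i) \<le>
        ennreal (1 - exp (- s)) * (ennreal (2 + s) * (\<Sum>i\<in>UNIV. L i))"
      by (simp add: mult.assoc)
    then have "(\<Sum>i\<in>UNIV. G i) \<le> ennreal (2 + s) * (\<Sum>i\<in>UNIV. L i)"
      using hi(1) by (subst (asm) ennreal_mult_le_mult_iff) auto
    then have le: "enn2ereal (\<Sum>i\<in>UNIV. G i) \<le> ereal (2 + s) * liquid_welfare I A"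
      using s(1) by (simp add: less_eq_ennreal.rep_eq times_ennreal.rep_eq LW del: ennreal_plus)
    have "expect (measure_pmf p) (\<lambda>x. val I i (x i)) =
        enn2ereal (\<integral>\<^sup>+ q. ennreal (val I i q) \<partial>measure_pmf (P i))" for i
      by (subst expect_nonneg) (use p(1) v in \<open>auto simp: AE_measure_pmf_iff P_def\<close>)
    \<comment> \<open>Thinning attains the minimum of value and budget exactly, so
      \<open>G i\<close> is the capped value of the lottery.\<close>
    then have "(\<Sum>i\<in>UNIV. min (expect (measure_pmf p) (\<lambda>x. val I i (x i))) (budget I i)) =
        enn2ereal (\<Sum>i\<in>UNIV. G i)"
      by (simp add: sum_enn2ereal[OF zero_le, symmetric] G_def Q_val del: sum_enn2ereal)
    then show "(\<Sum>i\<in>UNIV. min (expect (measure_pmf p) (\<lambda>x. val I i (x i))) (budget I i)) \<le>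
        ereal (- lambert_Wm1 (- exp (- 2))) * liquid_welfare I A"
      using le by (simp add: s(3) add.commute)
  qed
qed

end
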